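(* Let $\beta\in(0,1)$, $\delta>0$, $\mu>0$, and suppose $$\max\left\{\frac{|\delta+\mu|}{1+\beta},\frac{|\delta-\mu|}{1-\beta}\right\}\rho(G)<1\qquad\text{and}\qquad \mu<\delta .$$ Then the following assertions apply to the problem $\boldsymbol P$ (with $s^+$, $s^-$ and essential (in)feasibility as defined in the context). (i) If $\mu<\beta\delta$, then $s^+$ is true and $\boldsymbol P$ is essentially feasible regardless of the network structure. (ii) If $\mu>\beta\delta$, there exist $G\in\{0,1\}^{n\times n}$ and $\delta>0$ for which $s^-$ is true and $\boldsymbol P$ is essentially infeasible. (iii) If $\mu>\max\left\{\frac{2\beta}{1+\beta^2}\delta,\ \frac{\beta}{d_{\min}}\right\}$, then $s^-$ is true and $\boldsymbol P$ is essentially infeasible regardless of the network structure.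
   Context: There are $n$ agents. $G=(g_{ij})\in\{0,1\}^{n\times n}$ is the symmetric, zero-diagonal adjacency matrix of an undirected connected graph (the strategic interaction network); $\rho(G)$ is its spectral radius and $d_{\min}$ the minimum node degree of the graph. All vector and matrix inequalities are entrywise. Let $$M^+:=((1+\beta)I-(\delta+\mu)G)^{-1},\quad M^-:=((1-\beta)I-(\delta-\mu)G)^{-1},\quad M_\Delta:=M^--M^+ .$$ Given price vectors $p^A,p^B\in\mathbb R^n_{\ge0}$ (of sustainable and unsustainable goods), agent $i$ with effort levels $x_i^A,x_i^B$ has utility $$u_i=p_i^Ax_i^A+p_i^Bx_i^B-\tfrac12(x_i^A)^2-\tfrac12(x_i^B)^2-\beta x_i^Ax_i^B+\delta\sum_jg_{ij}(x_i^Ax_j^A+x_i^Bx_j^B)+\mu\sum_jg_{ij}(x_i^Ax_j^B+x_i^Bx_j^A).$$ The equilibrium effort levels (the unique Nash equilibrium of the game with efforts in $\mathbb R$) are $$x^{A*}=\tfrac12\big((M^++M^-)p^A+(M^+-M^-)p^B\big),\qquad x^{B*}=\tfrac12\big((M^+-M^-)p^A+(M^++M^-)p^B\big).$$ Pre-intervention prices $p^{A0},p^{B0}\in\mathbb R^n_{\ge0}$ and an upper bound $p^{\max}\ge p^{A0}$, $p^{\max}\neq p^{A0}$, are given; $(x^{A0},x^{B0})$ is the equilibrium at $(p^{A0},p^{B0})$. Problem $\boldsymbol P$: with $p^B=p^{B0}$ fixed, maximize over $p^A\in\mathbb R^n$ the welfare $\sum_iu_i(x^{A*},x^{B*};p^A,p^B)$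 subject to $\sum_ix_i^{B*}\le\tau^B$ and $p^{A0}\le p^A\le p^{\max}$, where $\tau^B\ge0$ is a tolerance. $\boldsymbol P$ is essentially feasible if for some large enough $\tau^B$ its feasible set contains a $p^A$ whose equilibrium satisfies $\sum_ix_i^{B*}<\sum_ix_i^{B0}$; otherwise it is essentially infeasible. Outcome $s^+$: $M_\Delta$ has positive entries and the equilibrium value of $\sum_{i=1}^nx_i^{B*}$ decreases monotonically in each of the prices $p_j^A$, $j\in\{1,\dots,n\}$. Outcome $s^-$: $M_\Delta$ has negative off-diagonal entries and the equilibrium value of $\sum_{i=1}^nx_i^{B*}$ increases monotonically in each of the prices $p_j^A$, $j\in\{1,\dots,n\}$.
   Formalization: In (ii), n ≥ 2 is required and μ is rescaled with δ: G, δ' and μ' = (μ/δ)δ' are found that satisfy all standing conditions, since with μ held fixed the claim is false (n=2, β=.5, μ=.1, δ=.15). In (iii), d_min > 0 is assumed explicitly. *)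

theory Defs
  imports "HOL-Analysis.Analysis"
begin

section \<open>The network\<close>

text \<open>The agents are the elements of the finite index type \<open>'n\<close>, so that \<open>n = CARD('n)\<close>.\<close>

definition network :: "real^'n^'n \<Rightarrow> bool" where
  "network G \<longleftrightarrow>
     (\<forall>i j. G $ i $ j \<in> {0, 1}) \<and>
     (\<forall>i j. G $ i $ j = G $ j $ i) \<and>
     (\<forall>i. G $ i $ i = 0) \<and>
     (\<forall>i j. (i, j) \<in> {(k, l). G $ k $ l = 1}\<^sup>*)"

definition node_degree :: "real^'n^'n \<Rightarrow> 'n \<Rightarrow> nat" where
  "node_degree G i = card {j. G $ i $ j = 1}"

definition min_degree :: "real^'n^'n \<Rightarrow> nat" where
  "min_degree G = Min (range (node_degree G))"

definition is_eigenvalue :: "real^'n^'n \<Rightarrow> complex \<Rightarrow> bool" where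
  "is_eigenvalue A z \<longleftrightarrow>
     (\<exists>v :: complex^'n. v \<noteq> 0 \<and> map_matrix complex_of_real A *v v = z *s v)"

definition spec_radius :: "real^'n^'n \<Rightarrow> real" where
  "spec_radius A = Max {cmod z | z. is_eigenvalue A z}"

definition M_plus :: "real \<Rightarrow> real \<Rightarrow> real \<Rightarrow> real^'n^'n \<Rightarrow> real^'n^'n" where
  "M_plus \<beta> \<delta> \<mu> G = matrix_inv ((1 + \<beta>) *\<^sub>R mat 1 - (\<delta> + \<mu>) *\<^sub>R G)"

definition M_minus :: "real \<Rightarrow> real \<Rightarrow> real \<Rightarrow> real^'n^'n \<Rightarrow> real^'n^'n" where
  "M_minus \<beta> \<delta> \<mu> G = matrix_inv ((1 - \<beta>) *\<^sub>R mat 1 - (\<delta> - \<mu>) *\<^sub>R G)"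

definition M_Delta :: "real \<Rightarrow> real \<Rightarrow> real \<Rightarrow> real^'n^'n \<Rightarrow> real^'n^'n" where
  "M_Delta \<beta> \<delta> \<mu> G = M_minus \<beta> \<delta> \<mu> G - M_plus \<beta> \<delta> \<mu> G"


section \<open>The game\<close>

definition utility ::
  "real \<Rightarrow> real \<Rightarrow> real \<Rightarrow> real^'n^'n \<Rightarrow> real^'n \<Rightarrow> real^'n \<Rightarrow> real^'n \<Rightarrow> real^'n \<Rightarrow> 'n \<Rightarrow> real" where
  "utility \<beta> \<delta> \<mu> G pA pB xA xB i =
     pA $ i * xA $ i + pB $ i * xB $ i - (xA $ i)\<^sup>2 / 2 - (xB $ i)\<^sup>2 / 2 - \<beta> * xA $ i * xB $ i
     + \<delta> * (\<Sum>j\<in>UNIV. G $ i $ j * (xA $ i * xA $ j + xB $ i * xB $ j))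
     + \<mu> * (\<Sum>j\<in>UNIV. G $ i $ j * (xA $ i * xB $ j + xB $ i * xA $ j))"

definition set_entry :: "real^'n \<Rightarrow> 'n \<Rightarrow> real \<Rightarrow> real^'n" where
  "set_entry x i a = (\<chi> j. if j = i then a else x $ j)"

definition nash_equilibrium ::
  "real \<Rightarrow> real \<Rightarrow> real \<Rightarrow> real^'n^'n \<Rightarrow> real^'n \<Rightarrow> real^'n \<Rightarrow> real^'n \<Rightarrow> real^'n \<Rightarrow> bool" where
  "nash_equilibrium \<beta> \<delta> \<mu> G pA pB xA xB \<longleftrightarrow>
     (\<forall>i a b. utility \<beta> \<delta> \<mu> G pA pB (set_entry xA i a) (set_entry xB i b) i
               \<le> utility \<beta> \<delta> \<mu> G pA pB xA xB i)"

text \<open>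
  The description operator is meaningful because the equilibrium exists and is unique; see
  \<open>equilibrium_eq\<close> below, which also gives its closed form.
\<close>

definition equilibrium ::
  "real \<Rightarrow> real \<Rightarrow> real \<Rightarrow> real^'n^'n \<Rightarrow> real^'n \<Rightarrow> real^'n \<Rightarrow> (real^'n) \<times> (real^'n)" where
  "equilibrium \<beta> \<delta> \<mu> G pA pB = (THE x. nash_equilibrium \<beta> \<delta> \<mu> G pA pB (fst x) (snd x))"

definition xA_eq ::
  "real \<Rightarrow> real \<Rightarrow> real \<Rightarrow> real^'n^'n \<Rightarrow> real^'n \<Rightarrow> real^'n \<Rightarrow> real^'n" where
  "xA_eq \<beta> \<delta> \<mu> G pA pB = fst (equilibrium \<beta> \<delta> \<mu> G pA pB)"

definition xB_eq ::
  "real \<Rightarrow> real \<Rightarrow> real \<Rightarrow> real^'n^'n \<Rightarrow> real^'n \<Rightarrow> real^'n \<Rightarrow> real^'n" where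
  "xB_eq \<beta> \<delta> \<mu> G pA pB = snd (equilibrium \<beta> \<delta> \<mu> G pA pB)"

definition total_xB ::
  "real \<Rightarrow> real \<Rightarrow> real \<Rightarrow> real^'n^'n \<Rightarrow> real^'n \<Rightarrow> real^'n \<Rightarrow> real" where
  "total_xB \<beta> \<delta> \<mu> G pA pB = (\<Sum>i\<in>UNIV. xB_eq \<beta> \<delta> \<mu> G pA pB $ i)"

definition welfare ::
  "real \<Rightarrow> real \<Rightarrow> real \<Rightarrow> real^'n^'n \<Rightarrow> real^'n \<Rightarrow> real^'n \<Rightarrow> real" where
  "welfare \<beta> \<delta> \<mu> G pA pB =
     (\<Sum>i\<in>UNIV. utility \<beta> \<delta> \<mu> G pA pB (xA_eq \<beta> \<delta> \<mu> G pA pB) (xB_eq \<beta> \<delta> \<mu> G pA pB) i)"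


section \<open>The intervention problem and its outcomes\<close>

record 'n maximization_problem =
  objective :: "real^'n \<Rightarrow> real"
  feasible_set :: "(real^'n) set"

definition problem_P ::
  "real \<Rightarrow> real \<Rightarrow> real \<Rightarrow> real^'n^'n \<Rightarrow> real^'n \<Rightarrow> real^'n \<Rightarrow> real^'n \<Rightarrow> real \<Rightarrow> 'n maximization_problem" where
  "problem_P \<beta> \<delta> \<mu> G pA0 pB0 pmax \<tau>B =
     \<lparr> objective = (\<lambda>pA. welfare \<beta> \<delta> \<mu> G pA pB0),
       feasible_set = {pA. total_xB \<beta> \<delta> \<mu> G pA pB0 \<le> \<tau>B \<and> pA0 \<le> pA \<and> pA \<le> pmax} \<rparr>"

definition essentially_feasible ::
  "real \<Rightarrow> real \<Rightarrow> real \<Rightarrow> real^'n^'n \<Rightarrow> real^'n \<Rightarrow> real^'n \<Rightarrow> real^'n \<Rightarrow> bool" where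
  "essentially_feasible \<beta> \<delta> \<mu> G pA0 pB0 pmax \<longleftrightarrow>
     (\<exists>\<tau>B \<ge> 0. \<exists>pA \<in> feasible_set (problem_P \<beta> \<delta> \<mu> G pA0 pB0 pmax \<tau>B).
        total_xB \<beta> \<delta> \<mu> G pA pB0 < total_xB \<beta> \<delta> \<mu> G pA0 pB0)"

abbreviation essentially_infeasible ::
  "real \<Rightarrow> real \<Rightarrow> real \<Rightarrow> real^'n^'n \<Rightarrow> real^'n \<Rightarrow> real^'n \<Rightarrow> real^'n \<Rightarrow> bool" where
  "essentially_infeasible \<beta> \<delta> \<mu> G pA0 pB0 pmax \<equiv> \<not> essentially_feasible \<beta> \<delta> \<mu> G pA0 pB0 pmax"

text \<open>``Monotonically'' is read strictly, over nonnegative price vectors.\<close>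

definition outcome_s_plus :: "real \<Rightarrow> real \<Rightarrow> real \<Rightarrow> real^'n^'n \<Rightarrow> bool" where
  "outcome_s_plus \<beta> \<delta> \<mu> G \<longleftrightarrow>
     (\<forall>i j. M_Delta \<beta> \<delta> \<mu> G $ i $ j > 0) \<and>
     (\<forall>pA \<ge> 0. \<forall>pB \<ge> 0. \<forall>j.
        strict_antimono_on {0..} (\<lambda>t. total_xB \<beta> \<delta> \<mu> G (set_entry pA j t) pB))"

definition outcome_s_minus :: "real \<Rightarrow> real \<Rightarrow> real \<Rightarrow> real^'n^'n \<Rightarrow> bool" where
  "outcome_s_minus \<beta> \<delta> \<mu> G \<longleftrightarrow>
     (\<forall>i j. i \<noteq> j \<longrightarrow> M_Delta \<beta> \<delta> \<mu> G $ i $ j < 0) \<and>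
     (\<forall>pA \<ge> 0. \<forall>pB \<ge> 0. \<forall>j.
        strict_mono_on {0..} (\<lambda>t. total_xB \<beta> \<delta> \<mu> G (set_entry pA j t) pB))"


section \<open>Closed form of the equilibrium\<close>

lemma quadratic_max_iff:
  fixes \<beta> :: real
  assumes "-1 < \<beta>" "\<beta> < 1"
  shows "(\<forall>a b. p * a + q * b - a\<^sup>2 / 2 - b\<^sup>2 / 2 - \<beta> * a * b
                \<le> p * x + q * y - x\<^sup>2 / 2 - y\<^sup>2 / 2 - \<beta> * x * y)
         \<longleftrightarrow> p = x + \<beta> * y \<and> q = y + \<beta> * x" (is "?L \<longleftrightarrow> ?R")
proof -
  define F where "F a b = p * a + q * b - a\<^sup>2 / 2 - b\<^sup>2 / 2 - \<beta> * a * b" for a b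
  show ?thesis
  proof
    assume ?L
    hence L: "F a b \<le> F x y" for a b by (simp add: F_def)
    define r where "r = p - x - \<beta> * y"
    define s where "s = q - y - \<beta> * x"
    have "F (x + r) y = F x y + r\<^sup>2 / 2"
      by (simp add: F_def r_def field_simps power2_eq_square)
    with L[of "x + r" y] have "r = 0" by simp
    moreover have "F x (y + s) = F x y + s\<^sup>2 / 2"
      by (simp add: F_def s_def field_simps power2_eq_square)
    with L[of x "y + s"] have "s = 0" by simp
    ultimately show ?R by (simp add: r_def s_def)
  next
    assume R: ?R
    have "F a b \<le> F x y" for a b
    proof -
      have "F x y - F a b = ((a - x) + \<beta> * (b - y))\<^sup>2 / 2 + (1 - \<beta>\<^sup>2) * (b - y)\<^sup>2 / 2"
        using R by (simp add: F_def field_simps power2_eq_square)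
      moreover have "\<beta>\<^sup>2 \<le> 1"
        using assms by (simp add: abs_square_le_1)
      ultimately show ?thesis by (smt (verit) divide_nonneg_nonneg mult_nonneg_nonneg zero_le_power2)
    qed
    thus ?L by (simp add: F_def)
  qed
qed

lemma nash_iff_first_order:
  fixes G :: "real^'n^'n"
  assumes "-1 < \<beta>" "\<beta> < 1" "\<And>i. G $ i $ i = 0"
  shows "nash_equilibrium \<beta> \<delta> \<mu> G pA pB xA xB \<longleftrightarrow>
           pA = xA + \<beta> *\<^sub>R xB - \<delta> *\<^sub>R (G *v xA) - \<mu> *\<^sub>R (G *v xB) \<and>
           pB = xB + \<beta> *\<^sub>R xA - \<delta> *\<^sub>R (G *v xB) - \<mu> *\<^sub>R (G *v xA)"
proof -
  define P where "P i = pA $ i + \<delta> * (G *v xA) $ i + \<mu> * (G *v xB) $ i" for i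
  define Q where "Q i = pB $ i + \<delta> * (G *v xB) $ i + \<mu> * (G *v xA) $ i" for i
  have sums: "(\<Sum>j\<in>UNIV. G $ i $ j * set_entry x i a $ j) = (G *v x) $ i" for x i a
    unfolding matrix_vector_mult_def
    by (simp add: set_entry_def) (rule sum.cong, auto simp: assms(3))
  have lin: "(\<Sum>j\<in>UNIV. G $ i $ j * (c * f j + d * h j)) =
      c * (\<Sum>j\<in>UNIV. G $ i $ j * f j) + d * (\<Sum>j\<in>UNIV. G $ i $ j * h j)" for i c d and f h :: "'n \<Rightarrow> real"
    by (simp add: sum_distrib_left sum.distrib algebra_simps)
  have own: "set_entry x i a $ i = a" for x i and a :: real
    by (simp add: set_entry_def)
  have u: "utility \<beta> \<delta> \<mu> G pA pB (set_entry xA i a) (set_entry xB i b) i =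
      P i * a + Q i * b - a\<^sup>2 / 2 - b\<^sup>2 / 2 - \<beta> * a * b" for i a b
    unfolding utility_def lin sums own P_def Q_def by (simp add: algebra_simps)
  have id: "set_entry x i (x $ i) = x" for x :: "real^'n" and i
    by (simp add: set_entry_def vec_eq_iff)
  have u': "utility \<beta> \<delta> \<mu> G pA pB xA xB i =
      P i * xA $ i + Q i * xB $ i - (xA $ i)\<^sup>2 / 2 - (xB $ i)\<^sup>2 / 2 - \<beta> * xA $ i * xB $ i" for i
    using u[of i "xA $ i" "xB $ i"] by (simp add: id)
  have "nash_equilibrium \<beta> \<delta> \<mu> G pA pB xA xB \<longleftrightarrow>
      (\<forall>i. P i = xA $ i + \<beta> * xB $ i \<and> Q i = xB $ i + \<beta> * xA $ i)"
    unfolding nash_equilibrium_def u u' using quadratic_max_iff[OF assms(1,2)] by simp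
  also have "\<dots> \<longleftrightarrow>
      (\<forall>i. pA $ i = xA $ i + \<beta> * xB $ i - \<delta> * (G *v xA) $ i - \<mu> * (G *v xB) $ i) \<and>
      (\<forall>i. pB $ i = xB $ i + \<beta> * xA $ i - \<delta> * (G *v xB) $ i - \<mu> * (G *v xA) $ i)"
    unfolding P_def Q_def by (smt (verit))
  finally show ?thesis by (simp add: vec_eq_iff)
qed

lemma inv_mult_eq_iff:
  fixes A :: "real^'n^'n"
  assumes "invertible A"
  shows "A *v x = y \<longleftrightarrow> x = matrix_inv A *v y"
proof -
  have "A ** matrix_inv A = mat 1 \<and> matrix_inv A ** A = mat 1"
    using assms unfolding invertible_def matrix_inv_def by (rule someI_ex)
  thus ?thesis
    by (metis matrix_vector_mul_assoc matrix_vector_mul_lid)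
qed

lemma nash_iff_closed_form:
  fixes G :: "real^'n^'n"
  assumes "-1 < \<beta>" "\<beta> < 1" "\<And>i. G $ i $ i = 0"
    and "invertible ((1 + \<beta>) *\<^sub>R mat 1 - (\<delta> + \<mu>) *\<^sub>R G)"
    and "invertible ((1 - \<beta>) *\<^sub>R mat 1 - (\<delta> - \<mu>) *\<^sub>R G)"
  defines "Mp \<equiv> M_plus \<beta> \<delta> \<mu> G" and "Mm \<equiv> M_minus \<beta> \<delta> \<mu> G"
  shows "nash_equilibrium \<beta> \<delta> \<mu> G pA pB xA xB \<longleftrightarrow>
           xA = (1/2) *\<^sub>R ((Mp + Mm) *v pA + (Mp - Mm) *v pB) \<and>
           xB = (1/2) *\<^sub>R ((Mp - Mm) *v pA + (Mp + Mm) *v pB)"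
proof -
  note mv = matrix_vector_mult_diff_rdistrib matrix_vector_mult_add_rdistrib
    matrix_vector_right_distrib matrix_vector_mult_diff_distrib matrix_vector_mult_scaleR
    scaleR_matrix_vector_assoc[symmetric]
  have plus: "((1 + \<beta>) *\<^sub>R mat 1 - (\<delta> + \<mu>) *\<^sub>R G) *v (xA + xB) = pA + pB \<longleftrightarrow>
      xA + xB = Mp *v (pA + pB)"
    unfolding Mp_def M_plus_def by (rule inv_mult_eq_iff[OF assms(4)])
  have minus: "((1 - \<beta>) *\<^sub>R mat 1 - (\<delta> - \<mu>) *\<^sub>R G) *v (xA - xB) = pA - pB \<longleftrightarrow>
      xA - xB = Mm *v (pA - pB)"
    unfolding Mm_def M_minus_def by (rule inv_mult_eq_iff[OF assms(5)])
  have half: "a = c \<and> b = d \<longleftrightarrow> a + b = c + d \<and> a - b = c - d" for a b c d :: "real^'n"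
    by (auto simp: vec_eq_iff) (smt (verit))+
  have "nash_equilibrium \<beta> \<delta> \<mu> G pA pB xA xB \<longleftrightarrow>
      ((1 + \<beta>) *\<^sub>R mat 1 - (\<delta> + \<mu>) *\<^sub>R G) *v (xA + xB) = pA + pB \<and>
      ((1 - \<beta>) *\<^sub>R mat 1 - (\<delta> - \<mu>) *\<^sub>R G) *v (xA - xB) = pA - pB"
    unfolding nash_iff_first_order[OF assms(1-3)]
    by (subst half) (simp add: mv algebra_simps, metis)
  also have "\<dots> \<longleftrightarrow> xA + xB = Mp *v (pA + pB) \<and> xA - xB = Mm *v (pA - pB)"
    unfolding plus minus ..
  also have "\<dots> \<longleftrightarrow>
      xA = (1/2) *\<^sub>R ((Mp + Mm) *v pA + (Mp - Mm) *v pB) \<and>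
      xB = (1/2) *\<^sub>R ((Mp - Mm) *v pA + (Mp + Mm) *v pB)"
    by (subst (2) half) (simp add: mv vec_eq_iff field_simps)
  finally show ?thesis .
qed

lemma equilibrium_eq:
  fixes G :: "real^'n^'n"
  assumes "-1 < \<beta>" "\<beta> < 1" "\<And>i. G $ i $ i = 0"
    and "invertible ((1 + \<beta>) *\<^sub>R mat 1 - (\<delta> + \<mu>) *\<^sub>R G)"
    and "invertible ((1 - \<beta>) *\<^sub>R mat 1 - (\<delta> - \<mu>) *\<^sub>R G)"
  defines "Mp \<equiv> M_plus \<beta> \<delta> \<mu> G" and "Mm \<equiv> M_minus \<beta> \<delta> \<mu> G"
  shows "xA_eq \<beta> \<delta> \<mu> G pA pB = (1/2) *\<^sub>R ((Mp + Mm) *v pA + (Mp - Mm) *v pB)"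
    and "xB_eq \<beta> \<delta> \<mu> G pA pB = (1/2) *\<^sub>R ((Mp - Mm) *v pA + (Mp + Mm) *v pB)"
proof -
  have "equilibrium \<beta> \<delta> \<mu> G pA pB =
      ((1/2) *\<^sub>R ((Mp + Mm) *v pA + (Mp - Mm) *v pB),
       (1/2) *\<^sub>R ((Mp - Mm) *v pA + (Mp + Mm) *v pB))"
    unfolding equilibrium_def nash_iff_closed_form[OF assms(1-5)] Mp_def Mm_def
    by (rule the_equality) (auto simp: prod_eq_iff)
  thus "xA_eq \<beta> \<delta> \<mu> G pA pB = (1/2) *\<^sub>R ((Mp + Mm) *v pA + (Mp - Mm) *v pB)"
    and "xB_eq \<beta> \<delta> \<mu> G pA pB = (1/2) *\<^sub>R ((Mp - Mm) *v pA + (Mp + Mm) *v pB)"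
    by (simp_all add: xA_eq_def xB_eq_def)
qed

end

theory Submission
  imports Defs
begin

text \<open>
  The effect of the price \<open>p\<^sub>j\<^sup>A\<close> on total unsustainable effort is minus half the \<open>j\<close>-th column sum of
  \<open>M\<^sub>\<Delta>\<close>. If all column sums are positive, raising prices to \<open>p\<^sup>m\<^sup>a\<^sup>x\<close> lowers the total; if all are negative,
  no admissible increase can lower it. So everything reduces to the signs of the entries and of the
  column sums of \<open>M\<^sub>\<Delta> = M\<^sup>- - M\<^sup>+\<close>.

  Both \<open>M\<^sup>+\<close> and \<open>M\<^sup>-\<close> are inverses of matrices \<open>s I - t G\<close> with \<open>t \<rho>(G) < s\<close>. The Rayleigh quotient of a
  symmetric matrix is bounded by its spectral radius, so these matrices are positive definite; having
  nonpositive off-diagonal entries, they are then inverse-positive (\<open>inverse_nonneg\<close>), strictly so on a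
  connected graph. This order-theoretic fact takes the place of the Neumann series. It shows that
  \<open>s (s I - t G)\<^sup>-\<^sup>1\<close> increases with \<open>t / s\<close> (\<open>stieltjes_inverse_mono\<close>), and \<open>\<mu> < \<beta> \<delta>\<close>
  is precisely the condition that \<open>t / s\<close> be larger for \<open>M\<^sup>-\<close> than for \<open>M\<^sup>+\<close>.

  For \<open>\<mu> < \<beta> \<delta>\<close> the comparison is therefore in favour of \<open>M\<^sup>-\<close>, and so is the factor
  \<open>1 / s\<close>: all entries of \<open>M\<^sub>\<Delta>\<close> are positive (\<open>M_Delta_pos\<close>).

  For \<open>\<mu> > \<beta> \<delta>\<close> the comparison is reversed while the factor \<open>1 / s\<close> still favours \<open>M\<^sup>-\<close>. Off the
  diagonal the terms of order zero in \<open>G\<close> are absent, and the comparison wins as soon as it does so for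
  the linear terms (\<open>M_Delta_offdiagonal_neg\<close>). For the column sums the terms of order zero matter,
  and the network must be dense enough to outweigh them: the exact condition on regular graphs is
  \<open>\<mu> d > \<beta>\<close>, and a minimum principle extends it to \<open>\<mu> d\<^sub>m\<^sub>i\<^sub>n > \<beta>\<close> for arbitrary graphs
  (\<open>influence_neg\<close>).

  The existence claim is witnessed by the complete graph, scaled so that \<open>\<mu> d > \<beta>\<close> holds within the
  admissible range of the spectral radius. There all off-diagonal entries are equal, so that they
  follow the sign of the column sums (\<open>complete_graph_M_Delta_offdiagonal_neg\<close>).
\<close>

section \<open>The spectral radius of a symmetric matrix\<close>

lemma inner_symmetric_matrix:
  fixes A :: "real^'n^'n"
  assumes "transpose A = A"
  shows "inner (A *v x) y = inner x (A *v y)"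
  by (metis assms dot_lmul_matrix transpose_matrix_vector)

lemma inner_complexified_symmetric_matrix:
  fixes A :: "real^'n^'n" and v w :: "complex^'n"
  assumes "transpose A = A"
  shows "inner (map_matrix complex_of_real A *v v) w = inner v (map_matrix complex_of_real A *v w)"
proof -
  have sym: "A $ i $ j = A $ j $ i" for i j
    using arg_cong[OF assms, of "\<lambda>M. M $ j $ i"] by (simp add: transpose_def)
  have "inner (map_matrix complex_of_real A *v v) w
      = (\<Sum>i\<in>UNIV. \<Sum>j\<in>UNIV. A $ i $ j * inner (v $ j) (w $ i))"
    by (simp add: inner_vec_def matrix_vector_mult_def inner_sum_left
        flip: scaleR_conv_of_real)
  also have "\<dots> = (\<Sum>j\<in>UNIV. \<Sum>i\<in>UNIV. A $ i $ j * inner (v $ j) (w $ i))"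
    by (rule sum.swap)
  also have "\<dots> = (\<Sum>j\<in>UNIV. \<Sum>i\<in>UNIV. A $ j $ i * inner (v $ j) (w $ i))"
    by (simp only: sym)
  also have "\<dots> = inner v (map_matrix complex_of_real A *v w)"
    by (simp add: inner_vec_def matrix_vector_mult_def inner_sum_right
        flip: scaleR_conv_of_real)
  finally show ?thesis .
qed

lemma inner_complex_multiples:
  "inner (z *s v) (w *s v) = Re (cnj z * w) * inner v (v :: complex^'n)"
  by (simp add: inner_vec_def inner_complex_def sum_distrib_left algebra_simps)

text \<open>
  For an eigenvector \<open>v\<close> the real inner products of \<open>A v\<close> with \<open>\<i> v\<close> and of \<open>v\<close> with \<open>A (\<i> v)\<close> agree
  by symmetry, but they are the imaginary part of the eigenvalue times \<open>\<bar>v\<bar>\<^sup>2\<close> with opposite signs.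
\<close>

lemma symmetric_eigenvalue_real:
  fixes A :: "real^'n^'n"
  assumes "transpose A = A" "is_eigenvalue A z"
  shows "z \<in> \<real>"
proof -
  obtain v where v: "v \<noteq> 0" "map_matrix complex_of_real A *v v = z *s v"
    using assms(2) by (auto simp: is_eigenvalue_def)
  have iv: "map_matrix complex_of_real A *v (\<i> *s v) = (\<i> * z) *s v"
    by (metis v(2) vector_scalar_commute vector_smult_assoc)
  have "inner (z *s v) (\<i> *s v) = inner (1 *s v) ((\<i> * z) *s v)"
    using inner_complexified_symmetric_matrix[OF assms(1), of v "\<i> *s v"] by (simp add: v(2) iv)
  hence "Im z * inner v v = - Im z * inner v v"
    unfolding inner_complex_multiples by simp
  hence "Im z = 0" using v(1) by simp
  thus ?thesis by (simp add: complex_is_Real_iff)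
qed

text \<open>
  The spectral radius is a \<^const>\<open>Max\<close>, which says nothing about infinite sets, so finiteness of the
  spectrum is needed before any eigenvalue can be compared with it. Eigenvectors for distinct (real)
  eigenvalues are orthogonal, and a Euclidean space has room for finitely many of them only.
\<close>

lemma finite_symmetric_eigenvalues:
  fixes A :: "real^'n^'n"
  assumes "transpose A = A"
  shows "finite {z. is_eigenvalue A z}"
proof -
  let ?E = "{z. is_eigenvalue A z}" and ?A = "map_matrix complex_of_real A"
  have "\<forall>z\<in>?E. \<exists>v. v \<noteq> 0 \<and> ?A *v v = z *s v" by (simp add: is_eigenvalue_def)
  then obtain v where "\<forall>z\<in>?E. v z \<noteq> 0 \<and> ?A *v v z = z *s v z" by (rule bchoice[THEN exE])
  hence v: "v z \<noteq> 0" "?A *v v z = z *s v z" if "z \<in> ?E" for z using that by blast+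
  have orth: "inner (v z) (v w) = 0" if zw: "z \<in> ?E" "w \<in> ?E" "z \<noteq> w" for z w
  proof -
    obtain a b where ab: "z = of_real a" "w = of_real b"
      using symmetric_eigenvalue_real[OF assms] zw(1,2) by (metis Reals_cases mem_Collect_eq)
    have real_scale: "complex_of_real c *s u = c *\<^sub>R u" for c and u :: "complex^'n"
      unfolding vec_eq_iff vector_smult_component vector_scaleR_component
      by (simp add: scaleR_conv_of_real)
    have "inner (?A *v v z) (v w) = inner (v z) (?A *v v w)"
      by (rule inner_complexified_symmetric_matrix[OF assms])
    hence "inner (z *s v z) (v w) = inner (v z) (w *s v w)"
      by (simp only: v(2)[OF zw(1)] v(2)[OF zw(2)])
    hence "a * inner (v z) (v w) = b * inner (v z) (v w)"
      by (simp only: ab real_scale inner_scaleR_left inner_scaleR_right)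
    thus ?thesis using zw(3) ab by simp
  qed
  have "pairwise orthogonal (v ` ?E)"
    unfolding pairwise_def orthogonal_def using orth by blast
  hence "finite (v ` ?E)" by (rule pairwise_orthogonal_imp_finite)
  moreover have "inj_on v ?E"
    using orth v(1) by (metis inj_onI inner_eq_zero_iff)
  ultimately show ?thesis by (rule finite_imageD)
qed

lemma
  fixes A :: "real^'n^'n"
  assumes "transpose A = A" "u \<noteq> 0" "A *v u = \<theta> *\<^sub>R u"
  shows is_eigenvalue_of_real: "is_eigenvalue A (of_real \<theta>)"
    and eigenvalue_le_spec_radius: "\<theta> \<le> spec_radius A"
proof -
  let ?v = "\<chi> i. complex_of_real (u $ i)"
  have "?v \<noteq> 0" using assms(2) by (auto simp: vec_eq_iff)
  moreover have "map_matrix complex_of_real A *v ?v = of_real \<theta> *s ?v"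
  proof -
    have "(\<Sum>j\<in>UNIV. A $ i $ j * u $ j) = \<theta> * u $ i" for i
      using arg_cong[OF assms(3), of "\<lambda>x. x $ i"] by (simp add: matrix_vector_mult_def)
    thus ?thesis
      by (simp add: vec_eq_iff matrix_vector_mult_def flip: of_real_mult of_real_sum)
  qed
  ultimately show ev: "is_eigenvalue A (of_real \<theta>)"
    unfolding is_eigenvalue_def by blast
  have "finite {cmod z | z. is_eigenvalue A z}"
    using finite_symmetric_eigenvalues[OF assms(1)] by simp
  hence "cmod (of_real \<theta>) \<le> spec_radius A"
    unfolding spec_radius_def using ev by (intro Max_ge) blast+
  thus "\<theta> \<le> spec_radius A" by simp
qed

text \<open>
  The maximum of the Rayleigh quotient over the compact unit sphere is attained, and a point where it
  is attained is a critical point, hence an eigenvector. With the previous lemma this bounds the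
  quadratic form of \<open>A\<close> by \<^term>\<open>spec_radius A\<close>.
\<close>

lemma rayleigh_maximum_eigenvector:
  fixes A :: "real^'n^'n"
  assumes "transpose A = A"
  obtains \<theta> u where "u \<noteq> 0" "A *v u = \<theta> *\<^sub>R u" "\<And>x. inner x (A *v x) \<le> \<theta> * inner x x"
proof -
  have ne: "sphere (0::real^'n) 1 \<noteq> {}"
    using vector_choose_size[of 1, where 'a="real^'n"] by auto
  have "continuous_on (sphere 0 1) (\<lambda>x. inner x (A *v x))"
    by (intro continuous_intros linear_continuous_on matrix_vector_mul_bounded_linear)
  then obtain u where u: "norm u = 1" and max: "\<And>x. norm x = 1 \<Longrightarrow> inner x (A *v x) \<le> inner u (A *v u)"
    using continuous_attains_sup[OF compact_sphere ne] by force
  define \<theta> where "\<theta> = inner u (A *v u)"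
  have rayleigh: "inner x (A *v x) \<le> \<theta> * inner x x" for x
  proof (cases "x = 0")
    case False
    let ?y = "(1 / norm x) *\<^sub>R x"
    have "inner ?y (A *v ?y) = inner x (A *v x) / inner x x"
      by (simp add: matrix_vector_mult_scaleR dot_square_norm power2_eq_square)
    moreover have "inner ?y (A *v ?y) \<le> \<theta>"
      unfolding \<theta>_def using False by (intro max) simp
    ultimately have "inner x (A *v x) / inner x x \<le> \<theta>" by simp
    thus ?thesis using False by (simp add: divide_le_eq)
  qed simp
  define q where "q x = \<theta> * inner x x - inner x (A *v x)" for x
  define h where "h = \<theta> *\<^sub>R u - A *v u"
  \<comment> \<open>The form \<open>q\<close> is nonnegative and vanishes at \<open>u\<close>, so its gradient there, twice \<open>h\<close>, is zero.\<close>
  have expand: "q (u - s *\<^sub>R h) = s\<^sup>2 * q h - 2 * s * inner h h" for s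
  proof -
    have cross: "inner h (A *v u) = inner u (A *v h)"
      using inner_symmetric_matrix[OF assms, of u h] by (simp add: inner_commute)
    have "inner h h = inner h (\<theta> *\<^sub>R u - A *v u)" by (simp only: h_def)
    hence hh: "inner h h = \<theta> * inner u h - inner u (A *v h)"
      by (simp add: inner_diff_right cross inner_commute[of h u])
    have qu: "\<theta> * inner u u - inner u (A *v u) = 0"
      using u by (simp add: \<theta>_def dot_square_norm)
    have Ax: "A *v (u - s *\<^sub>R h) = A *v u - s *\<^sub>R (A *v h)"
      by (simp add: matrix_vector_mult_diff_distrib matrix_vector_mult_scaleR)
    have "q (u - s *\<^sub>R h) = (\<theta> * inner u u - inner u (A *v u)) + s\<^sup>2 * q h
        - 2 * s * (\<theta> * inner u h - inner u (A *v h))"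
      unfolding q_def Ax
      by (simp add: inner_diff_left inner_diff_right cross inner_commute[of h u]
          algebra_simps power2_eq_square)
    thus ?thesis by (simp only: qu hh)
  qed
  have "h = 0"
  proof (rule ccontr)
    assume "h \<noteq> 0"
    hence hh: "inner h h > 0" by simp
    have qh: "q h \<ge> 0" using rayleigh by (simp add: q_def)
    \<comment> \<open>A step against the gradient so short that the linear gain beats the quadratic loss
      \<open>s\<^sup>2 * q h\<close>; the \<open>+ 1\<close> keeps the denominator positive.\<close>
    define s where "s = inner h h / (q h + 1)"
    have s: "s > 0" "s * (q h + 1) = inner h h" using hh qh by (simp_all add: s_def)
    have "0 \<le> q (u - s *\<^sub>R h)" using rayleigh by (simp add: q_def)
    also have "\<dots> = s * (s * q h - 2 * (s * (q h + 1)))"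
      unfolding expand s(2) by (simp add: power2_eq_square algebra_simps)
    also have "\<dots> = - s\<^sup>2 * (q h + 2)"
      by (simp add: power2_eq_square algebra_simps)
    also have "\<dots> < 0" using s(1) qh by (simp add: mult_less_0_iff)
    finally show False by simp
  qed
  hence "A *v u = \<theta> *\<^sub>R u" by (simp add: h_def)
  moreover have "u \<noteq> 0" using u by auto
  ultimately show ?thesis using rayleigh that by blast
qed

lemma spec_radius_attained:
  fixes A :: "real^'n^'n"
  assumes "transpose A = A"
  obtains z where "is_eigenvalue A z" "spec_radius A = cmod z"
proof -
  obtain \<theta> u where "u \<noteq> 0" "A *v u = \<theta> *\<^sub>R u"
    using rayleigh_maximum_eigenvector[OF assms] by metis
  hence "is_eigenvalue A (of_real \<theta>)" by (rule is_eigenvalue_of_real[OF assms])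
  moreover have "finite {cmod z | z. is_eigenvalue A z}"
    using finite_symmetric_eigenvalues[OF assms] by simp
  ultimately have "spec_radius A \<in> {cmod z | z. is_eigenvalue A z}"
    unfolding spec_radius_def by (intro Max_in) blast+
  thus ?thesis using that by blast
qed

lemma spec_radius_nonneg:
  fixes A :: "real^'n^'n"
  assumes "transpose A = A"
  shows "0 \<le> spec_radius A"
proof -
  obtain z where "spec_radius A = cmod z" using spec_radius_attained[OF assms] .
  thus ?thesis by simp
qed

section \<open>Inverse-positive matrices\<close>

lemma shifted_mult_component:
  "((s *\<^sub>R mat 1 - t *\<^sub>R G) *v x) $ i = s * x $ i - t * (G *v x) $ i"
  for G :: "real^'n^'n"
  by (simp add: matrix_vector_mult_diff_rdistrib flip: scaleR_matrix_vector_assoc)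

lemma nonneg_matrix_mult_mono:
  fixes G :: "real^'n^'n"
  assumes "\<And>i j. 0 \<le> G $ i $ j" "\<And>j. x $ j \<le> y $ j"
  shows "(G *v x) $ i \<le> (G *v y) $ i"
  using assms by (auto simp: matrix_vector_mult_def intro!: sum_mono mult_left_mono)

text \<open>
  A symmetric \<open>s I - t G\<close> with \<open>G \<ge> 0\<close> and \<open>t \<rho>(G) < s\<close> is a Stieltjes matrix. Its inverse is the Neumann
  series \<open>\<Sum> t\<^sup>k G\<^sup>k / s\<^sup>k\<^sup>+\<^sup>1\<close> and therefore nonnegative, but the arguments below use only the order properties
  of the equation \<open>(s I - t G) x = h\<close>, which follow from positive definiteness without any series.
\<close>

locale stieltjes =
  fixes G :: "real^'n^'n" and s t :: real
  assumes sym: "transpose G = G"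
    and nonneg: "\<And>i j. 0 \<le> G $ i $ j"
    and t_pos: "0 < t"
    and bound: "t * spec_radius G < s"
begin

abbreviation "A \<equiv> s *\<^sub>R mat 1 - t *\<^sub>R G"

lemma G_mult_nonneg: "(\<And>j. 0 \<le> x $ j) \<Longrightarrow> 0 \<le> (G *v x) $ i"
  using nonneg_matrix_mult_mono[OF nonneg, of 0 x i] by simp

lemma A_mult: "A *v x = s *\<^sub>R x - t *\<^sub>R (G *v x)"
  by (simp add: vec_eq_iff shifted_mult_component)

lemma pos_def:
  assumes "x \<noteq> 0"
  shows "0 < inner x (A *v x)"
proof -
  obtain \<theta> u where u: "u \<noteq> 0" "G *v u = \<theta> *\<^sub>R u" and le: "\<And>x. inner x (G *v x) \<le> \<theta> * inner x x"
    using rayleigh_maximum_eigenvector[OF sym] by blast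
  have "t * inner x (G *v x) \<le> t * (\<theta> * inner x x)"
    using le t_pos by simp
  also have "\<dots> \<le> t * (spec_radius G * inner x x)"
    using eigenvalue_le_spec_radius[OF sym u] t_pos by (intro mult_left_mono mult_right_mono) auto
  also have "\<dots> < s * inner x x"
    using bound assms by (simp add: mult.assoc[symmetric])
  finally show ?thesis by (simp add: A_mult inner_diff_right)
qed

lemma s_pos: "0 < s"
proof -
  let ?e = "axis undefined 1 :: real^'n"
  have "0 \<le> (G *v ?e) $ i" for i
    by (rule G_mult_nonneg) (simp add: axis_def)
  hence "0 \<le> inner ?e (G *v ?e)"
    by (simp add: inner_axis')
  hence "0 \<le> t * inner ?e (G *v ?e)" using t_pos by simp
  moreover have "0 < inner ?e (A *v ?e)"
    by (rule pos_def) (simp add: axis_eq_0_iff)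
  ultimately show ?thesis by (simp add: A_mult inner_diff_right inner_axis_axis)
qed

lemma invertible_A: "invertible A"
proof -
  have "x = 0" if "A *v x = 0" for x
    using pos_def[of x] that by auto
  thus ?thesis
    by (meson invertible_left_inverse matrix_left_invertible_ker)
qed

text \<open>
  Write \<open>x = p - m\<close> with the positive and negative parts of \<open>x\<close>. As \<open>m\<close> and \<open>p\<close> have disjoint support,
  \<open>\<langle>m, A p\<rangle> = - t \<langle>m, G p\<rangle> \<le> 0\<close>, so \<open>\<langle>m, A m\<rangle> = \<langle>m, A p\<rangle> - \<langle>m, A x\<rangle> \<le> 0\<close>, and positive definiteness leaves
  only \<open>m = 0\<close>.
\<close>

lemma inverse_nonneg:
  assumes "\<And>i. 0 \<le> (A *v x) $ i"
  shows "0 \<le> x $ i"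
proof -
  define p :: "real^'n" where "p = (\<chi> i. max (x $ i) 0)"
  define m :: "real^'n" where "m = (\<chi> i. max (- x $ i) 0)"
  have x: "x = p - m" by (simp add: p_def m_def vec_eq_iff max_def)
  have pm: "inner m p = 0" by (auto simp: inner_vec_def p_def m_def max_def intro!: sum.neutral)
  have "inner m (A *v m) = inner m (A *v p) - inner m (A *v x)"
    by (simp add: x matrix_vector_mult_diff_distrib inner_diff_right)
  also have "\<dots> = - t * inner m (G *v p) - inner m (A *v x)"
    by (simp add: A_mult inner_diff_right pm)
  also have "\<dots> \<le> 0"
  proof -
    have "0 \<le> (G *v p) $ i" for i by (rule G_mult_nonneg) (simp add: p_def)
    hence "0 \<le> inner m (G *v p)" by (auto simp: inner_vec_def m_def intro!: sum_nonneg)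
    moreover have "0 \<le> inner m (A *v x)"
      using assms by (auto simp: inner_vec_def m_def intro!: sum_nonneg)
    moreover have "0 \<le> t * inner m (G *v p)" if "0 \<le> inner m (G *v p)"
      using t_pos that by simp
    ultimately show ?thesis by linarith
  qed
  finally have "m = 0" using pos_def[of m] by (meson not_less)
  hence "max (- x $ i) 0 = 0" by (simp add: m_def vec_eq_iff)
  thus ?thesis by linarith
qed

lemma scaled_ge_image:
  assumes "\<And>i. 0 \<le> (A *v x) $ i"
  shows "(A *v x) $ i \<le> s * x $ i"
  using G_mult_nonneg[of x, OF inverse_nonneg[OF assms]] t_pos by (simp add: shifted_mult_component)

text \<open>
  Where the right-hand side is positive, so is \<open>x\<close>; and positivity of \<open>x\<close> at a node passes to each
  neighbour because \<open>s x \<ge> t G x\<close>. Along paths it reaches the whole graph.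
\<close>

lemma inverse_positive_if_connected:
  assumes conn: "\<And>i j. (i, j) \<in> {(k, l). 0 < G $ k $ l}\<^sup>*"
    and h: "\<And>i. 0 \<le> (A *v x) $ i" "0 < (A *v x) $ j"
  shows "0 < x $ i"
  using conn[of i j]
proof (induction rule: converse_rtrancl_induct)
  case base
  have "0 < s * x $ j" using h(2) scaled_ge_image[OF h(1)] by (rule less_le_trans)
  thus ?case using s_pos by (simp add: zero_less_mult_iff)
next
  case (step k l)
  have "0 < G $ k $ l * x $ l" using step by simp
  also have "\<dots> \<le> (G *v x) $ k"
    unfolding matrix_vector_mult_def
    using nonneg inverse_nonneg[OF h(1)] by (auto intro!: member_le_sum)
  finally have "0 < t * (G *v x) $ k" using t_pos by simp
  also have "\<dots> \<le> s * x $ k" using h(1)[of k] by (simp add: shifted_mult_component)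
  finally show ?case using s_pos by (simp add: zero_less_mult_iff)
qed

end

text \<open>
  \<open>s x = (I - a G)\<^sup>-\<^sup>1 h\<close> with \<open>a = t / s\<close>, and this grows with \<open>a\<close>. Without inverses: applying the
  primed matrix to \<open>s' y - s x\<close> gives \<open>(t' s - t s') G x\<close>, which is nonnegative, and inverse
  positivity does the rest.
\<close>

lemma stieltjes_inverse_mono:
  fixes G :: "real^'n^'n"
  assumes "stieltjes G s t" "stieltjes G s' t'"
    and le: "t * s' \<le> t' * s"
    and x: "(s *\<^sub>R mat 1 - t *\<^sub>R G) *v x = h"
    and y: "(s' *\<^sub>R mat 1 - t' *\<^sub>R G) *v y = h"
    and h: "\<And>i. 0 \<le> h $ i"
  shows "s * x $ i \<le> s' * y $ i"
proof -
  interpret X: stieltjes G s t by fact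
  interpret Y: stieltjes G s' t' by fact
  have Gx: "0 \<le> (G *v x) $ i" for i
    by (rule X.G_mult_nonneg, rule X.inverse_nonneg) (simp add: x h)
  have "(Y.A *v (s' *\<^sub>R y - s *\<^sub>R x)) $ i = (t' * s - t * s') * (G *v x) $ i" for i
  proof -
    have "(Y.A *v (s' *\<^sub>R y - s *\<^sub>R x)) $ i = s' * (Y.A *v y) $ i - s * (Y.A *v x) $ i"
      by (simp add: matrix_vector_mult_diff_distrib matrix_vector_mult_scaleR)
    also have "\<dots> = s' * (X.A *v x) $ i - s * (Y.A *v x) $ i" by (simp only: x y)
    finally show ?thesis
      unfolding shifted_mult_component by (simp add: algebra_simps)
  qed
  hence "0 \<le> (s' *\<^sub>R y - s *\<^sub>R x) $ i"
    using Gx le by (intro Y.inverse_nonneg[of "s' *\<^sub>R y - s *\<^sub>R x"]) (simp only:, simp)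
  thus ?thesis by simp
qed

context stieltjes
begin

lemma A_inverse: "A *v (matrix_inv A *v x) = x"
  using inv_mult_eq_iff[OF invertible_A] by metis

lemma shifted_eq: "s * (matrix_inv A *v x) $ i = x $ i + t * (G *v (matrix_inv A *v x)) $ i"
  using arg_cong[OF A_inverse[of x], of "\<lambda>y. y $ i"] by (simp add: shifted_mult_component)

text \<open>
  The inverse of a symmetric matrix is symmetric, so its column sums are row sums, that is, the
  solution of \<open>(s I - t G) x = 1\<close>. The sign of a column sum becomes a comparison of two such solutions.
\<close>

lemma inverse_column_sum: "(\<Sum>i\<in>UNIV. matrix_inv A $ i $ j) = (matrix_inv A *v 1) $ j"
proof -
  let ?e = "axis j 1 :: real^'n"
  have "transpose A = A"
    using sym by (simp add: transpose_def vec_eq_iff mat_def)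
  hence "inner (A *v (matrix_inv A *v 1)) (matrix_inv A *v ?e)
      = inner (matrix_inv A *v 1) (A *v (matrix_inv A *v ?e))"
    by (rule inner_symmetric_matrix)
  hence "inner 1 (matrix_inv A *v ?e) = (matrix_inv A *v 1) $ j"
    by (simp add: A_inverse inner_axis)
  thus ?thesis
    by (simp add: matrix_vector_mult_basis column_def inner_vec_def)
qed

text \<open>
  On the complete graph \<open>G y = S 1 - y\<close> with \<open>S\<close> the sum of the entries of \<open>y\<close>, so a column of the
  inverse has only one off-diagonal value. Adding up the \<open>n\<close> equations of the column eliminates
  everything except that value and \<open>S\<close>.
\<close>

lemma complete_graph_inverse_entry:
  assumes "\<And>i j. G $ i $ j = (if i = j then 0 else 1)" and "i \<noteq> j"
  shows "real CARD('n) * matrix_inv A $ i $ j = (\<Sum>k\<in>UNIV. matrix_inv A $ k $ j) - 1 / (s + t)"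
proof -
  define y where "y = matrix_inv A *v axis j 1"
  have y: "y $ k = matrix_inv A $ k $ j" for k
    by (simp add: y_def matrix_vector_mult_basis column_def)
  define S where "S = (\<Sum>k\<in>UNIV. y $ k)"
  have Gy: "(G *v y) $ k = S - y $ k" for k
    unfolding matrix_vector_mult_def S_def
    by (simp add: assms(1) if_distrib[of "\<lambda>c. c * _"] sum.If_cases Compl_eq_Diff_UNIV
        sum.remove[of UNIV k] cong: if_cong)
  have eq: "(s + t) * y $ k - t * S = (if k = j then 1 else 0)" for k
  proof -
    have "(A *v y) $ k = (if k = j then 1 else 0)"
      unfolding y_def A_inverse by (simp add: axis_def)
    thus ?thesis unfolding shifted_mult_component Gy by (simp add: algebra_simps)
  qed
  have "(s + t) * S - real CARD('n) * (t * S) = (\<Sum>k\<in>UNIV. (s + t) * y $ k - t * S)"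
    by (simp add: S_def sum_subtractf sum_distrib_left)
  also have "\<dots> = 1" by (simp add: eq)
  finally have "real CARD('n) * (t * S) = (s + t) * S - 1" by simp
  moreover have "t * S = (s + t) * y $ i" using eq[of i] assms(2) by simp
  ultimately have "(s + t) * (real CARD('n) * y $ i) = (s + t) * S - 1"
    by (metis mult.left_commute)
  moreover have "s + t > 0" using s_pos t_pos by simp
  ultimately show ?thesis by (simp add: y S_def field_simps)
qed

end

section \<open>Networks\<close>

lemma
  assumes "network G"
  shows network_transpose: "transpose G = G"
    and network_nonneg: "0 \<le> G $ i $ j"
    and network_connected: "(i, j) \<in> {(k, l). 0 < G $ k $ l}\<^sup>*"
proof -
  show "transpose G = G"
    using assms by (simp add: network_def transpose_def vec_eq_iff)
  have "G $ i $ j \<in> {0, 1}" using assms unfolding network_def by blast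
  thus "0 \<le> G $ i $ j" by auto
  have "(i, j) \<in> {(k, l). G $ k $ l = 1}\<^sup>*" using assms unfolding network_def by blast
  moreover have "{(k, l). G $ k $ l = 1} \<subseteq> {(k, l). 0 < G $ k $ l}" by auto
  ultimately show "(i, j) \<in> {(k, l). 0 < G $ k $ l}\<^sup>*" using rtrancl_mono by blast
qed

lemma network_mult_one:
  assumes "network G"
  shows "(G *v 1) $ i = real (node_degree G i)"
proof -
  have "G $ i $ j = (if G $ i $ j = 1 then 1 else 0)" for j
  proof -
    have "G $ i $ j \<in> {0, 1}" using assms unfolding network_def by blast
    thus ?thesis by auto
  qed
  hence "(G *v 1) $ i = (\<Sum>j\<in>UNIV. if G $ i $ j = 1 then 1 else 0)"
    by (simp add: matrix_vector_mult_def)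
  thus ?thesis by (simp add: node_degree_def sum.If_cases)
qed

lemma min_degree_mult_le:
  assumes "network G" "0 \<le> m" "\<And>j. m \<le> y $ j"
  shows "real (min_degree G) * m \<le> (G *v y) $ i"
proof -
  have "real (min_degree G) * m \<le> real (node_degree G i) * m"
    using assms(2) by (intro mult_right_mono) (auto simp: min_degree_def)
  also have "\<dots> = (G *v (m *\<^sub>R 1)) $ i"
    by (simp add: matrix_vector_mult_scaleR network_mult_one[OF assms(1)])
  also have "\<dots> \<le> (G *v y) $ i"
    by (rule nonneg_matrix_mult_mono[OF network_nonneg[OF assms(1)]]) (simp add: assms(3))
  finally show ?thesis .
qed

section \<open>Comparative statics of the equilibrium\<close>

locale network_game =
  fixes G :: "real^'n^'n" and \<beta> \<delta> \<mu> :: real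
  assumes net: "network G"
    and \<beta>: "0 < \<beta>" "\<beta> < 1"
    and \<mu>: "0 < \<mu>" "\<mu> < \<delta>"
    and radius: "max (\<bar>\<delta> + \<mu>\<bar> / (1 + \<beta>)) (\<bar>\<delta> - \<mu>\<bar> / (1 - \<beta>)) * spec_radius G < 1"
begin

lemma spec_radius_bounds:
  "(\<delta> + \<mu>) * spec_radius G < 1 + \<beta>" "(\<delta> - \<mu>) * spec_radius G < 1 - \<beta>"
proof -
  have nonneg: "0 \<le> spec_radius G"
    by (rule spec_radius_nonneg[OF network_transpose[OF net]])
  have "\<bar>\<delta> + \<mu>\<bar> / (1 + \<beta>) * spec_radius G < 1" "\<bar>\<delta> - \<mu>\<bar> / (1 - \<beta>) * spec_radius G < 1"
    by (rule le_less_trans[OF mult_right_mono[OF _ nonneg] radius], simp)+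
  thus "(\<delta> + \<mu>) * spec_radius G < 1 + \<beta>" "(\<delta> - \<mu>) * spec_radius G < 1 - \<beta>"
    using \<beta> \<mu> by (simp_all add: divide_less_eq)
qed

sublocale plus: stieltjes G "1 + \<beta>" "\<delta> + \<mu>"
  using \<mu> by unfold_locales
    (simp_all add: network_transpose[OF net] network_nonneg[OF net] spec_radius_bounds)

sublocale minus: stieltjes G "1 - \<beta>" "\<delta> - \<mu>"
  using \<mu> by unfold_locales
    (simp_all add: network_transpose[OF net] network_nonneg[OF net] spec_radius_bounds)

text \<open>
  Half of this number is the amount by which total unsustainable effort falls per unit of \<open>p\<^sub>j\<^sup>A\<close>; see
  the next lemma.
\<close>

abbreviation influence :: "'n \<Rightarrow> real" where
  "influence j \<equiv> \<Sum>i\<in>UNIV. M_Delta \<beta> \<delta> \<mu> G $ i $ j"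

lemma total_xB_diff:
  "total_xB \<beta> \<delta> \<mu> G pA pB - total_xB \<beta> \<delta> \<mu> G pA' pB
     = (\<Sum>j\<in>UNIV. influence j * (pA' $ j - pA $ j)) / 2"
proof -
  have diag: "G $ i $ i = 0" for i using net by (simp add: network_def)
  have \<beta>': "-1 < \<beta>" using \<beta> by simp
  note xB = equilibrium_eq(2)[OF \<beta>' \<beta>(2) diag plus.invertible_A minus.invertible_A]
  let ?D = "M_Delta \<beta> \<delta> \<mu> G"
  have "xB_eq \<beta> \<delta> \<mu> G pA pB - xB_eq \<beta> \<delta> \<mu> G pA' pB = (1/2) *\<^sub>R (?D *v (pA' - pA))"
    unfolding xB M_Delta_def
    by (simp add: matrix_vector_mult_diff_rdistrib matrix_vector_mult_diff_distrib algebra_simps)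
  hence "total_xB \<beta> \<delta> \<mu> G pA pB - total_xB \<beta> \<delta> \<mu> G pA' pB = (\<Sum>i\<in>UNIV. ((1/2) *\<^sub>R (?D *v (pA' - pA))) $ i)"
    unfolding total_xB_def by (simp flip: sum_subtractf vector_minus_component)
  also have "\<dots> = (\<Sum>i\<in>UNIV. \<Sum>j\<in>UNIV. ?D $ i $ j * (pA' $ j - pA $ j)) / 2"
    by (simp add: matrix_vector_mult_def sum_divide_distrib)
  also have "(\<Sum>i\<in>UNIV. \<Sum>j\<in>UNIV. ?D $ i $ j * (pA' $ j - pA $ j))
      = (\<Sum>j\<in>UNIV. influence j * (pA' $ j - pA $ j))"
    by (subst sum.swap) (simp add: sum_distrib_right)
  finally show ?thesis .
qed

lemma total_xB_set_entry_diff: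
  "total_xB \<beta> \<delta> \<mu> G (set_entry pA j a) pB - total_xB \<beta> \<delta> \<mu> G (set_entry pA j b) pB
     = influence j * (b - a) / 2"
proof -
  have "(\<Sum>k\<in>UNIV. influence k * (set_entry pA j b $ k - set_entry pA j a $ k))
      = (\<Sum>k\<in>UNIV. if k = j then influence j * (b - a) else 0)"
    by (rule sum.cong) (auto simp: set_entry_def)
  thus ?thesis by (simp add: total_xB_diff)
qed

lemma total_xB_strict_antimono:
  assumes "0 < influence j"
  shows "strict_antimono_on {0..} (\<lambda>t. total_xB \<beta> \<delta> \<mu> G (set_entry pA j t) pB)"
proof (rule monotone_onI)
  fix a b :: real assume "a < b"
  hence "0 < influence j * (b - a) / 2" using assms by simp
  thus "total_xB \<beta> \<delta> \<mu> G (set_entry pA j a) pB > total_xB \<beta> \<delta> \<mu> G (set_entry pA j b) pB"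
    using total_xB_set_entry_diff[of pA j a pB b] by linarith
qed

lemma total_xB_strict_mono:
  assumes "influence j < 0"
  shows "strict_mono_on {0..} (\<lambda>t. total_xB \<beta> \<delta> \<mu> G (set_entry pA j t) pB)"
proof (rule monotone_onI)
  fix a b :: real assume "a < b"
  hence "influence j * (b - a) / 2 < 0" using assms by (simp add: mult_neg_pos)
  thus "total_xB \<beta> \<delta> \<mu> G (set_entry pA j a) pB < total_xB \<beta> \<delta> \<mu> G (set_entry pA j b) pB"
    using total_xB_set_entry_diff[of pA j a pB b] by linarith
qed

lemma essentially_feasible_if_influence_pos:
  assumes pos: "\<And>j. 0 < influence j" and p: "pA0 \<le> pmax" "pmax \<noteq> pA0"
  shows "essentially_feasible \<beta> \<delta> \<mu> G pA0 pB0 pmax"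
proof -
  obtain k where "pmax $ k \<noteq> pA0 $ k" using p(2) by (auto simp: vec_eq_iff)
  hence k: "0 < influence k * (pmax $ k - pA0 $ k)"
    using p(1) pos by (simp add: less_eq_vec_def order.not_eq_order_implies_strict)
  have "0 \<le> influence j * (pmax $ j - pA0 $ j)" for j
    using p(1) less_imp_le[OF pos] by (intro mult_nonneg_nonneg) (simp_all add: less_eq_vec_def)
  hence "0 < (\<Sum>j\<in>UNIV. influence j * (pmax $ j - pA0 $ j))"
    using k by (intro sum_pos2[of UNIV k]) auto
  hence "total_xB \<beta> \<delta> \<mu> G pmax pB0 < total_xB \<beta> \<delta> \<mu> G pA0 pB0"
    using total_xB_diff[of pA0 pB0 pmax] by linarith
  moreover have "pmax \<in> feasible_set (problem_P \<beta> \<delta> \<mu> G pA0 pB0 pmax (max 0 (total_xB \<beta> \<delta> \<mu> G pmax pB0)))"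
    using p(1) by (simp add: problem_P_def)
  ultimately show ?thesis
    unfolding essentially_feasible_def by (meson max.cobounded1)
qed

lemma essentially_infeasible_if_influence_neg:
  assumes neg: "\<And>j. influence j < 0"
  shows "essentially_infeasible \<beta> \<delta> \<mu> G pA0 pB0 pmax"
proof -
  have "total_xB \<beta> \<delta> \<mu> G pA0 pB0 \<le> total_xB \<beta> \<delta> \<mu> G pA pB0" if "pA0 \<le> pA" for pA
  proof -
    have "influence j * (pA $ j - pA0 $ j) \<le> 0" for j
      using that less_imp_le[OF neg] by (intro mult_nonpos_nonneg) (simp_all add: less_eq_vec_def)
    hence "(\<Sum>j\<in>UNIV. influence j * (pA $ j - pA0 $ j)) \<le> 0" by (intro sum_nonpos) simp
    thus ?thesis using total_xB_diff[of pA0 pB0 pA] by linarith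
  qed
  thus ?thesis
    unfolding essentially_feasible_def problem_P_def by (simp add: not_less)
qed

lemma M_Delta_entry:
  "M_Delta \<beta> \<delta> \<mu> G $ i $ j
     = (matrix_inv minus.A *v axis j 1) $ i - (matrix_inv plus.A *v axis j 1) $ i"
  by (simp add: M_Delta_def M_plus_def M_minus_def matrix_vector_mult_basis column_def)

lemma influence_eq: "influence j = (matrix_inv minus.A *v 1) $ j - (matrix_inv plus.A *v 1) $ j"
  by (simp add: M_Delta_def M_plus_def M_minus_def sum_subtractf
      plus.inverse_column_sum minus.inverse_column_sum)

lemma plus_inverse_column_pos: "0 < (matrix_inv plus.A *v axis j 1) $ i"
  by (rule plus.inverse_positive_if_connected[OF network_connected[OF net], where j = j])
    (simp_all add: plus.A_inverse, simp add: axis_def)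

text \<open>
  Here \<open>(\<delta> + \<mu>) / (1 + \<beta>) < (\<delta> - \<mu>) / (1 - \<beta>)\<close>, so the column of \<open>M\<^sup>+\<close> times \<open>1 + \<beta>\<close> is at most the
  column of \<open>M\<^sup>-\<close> times \<open>1 - \<beta>\<close>. Since the former is positive, the gap between the two factors makes the
  inequality strict.
\<close>

lemma M_Delta_pos:
  assumes "\<mu> < \<beta> * \<delta>"
  shows "0 < M_Delta \<beta> \<delta> \<mu> G $ i $ j"
proof -
  let ?y = "matrix_inv plus.A *v axis j 1" and ?w = "matrix_inv minus.A *v axis j 1"
  have "(\<delta> + \<mu>) * (1 - \<beta>) \<le> (\<delta> - \<mu>) * (1 + \<beta>)" using assms by (simp add: algebra_simps)
  hence le: "(1 + \<beta>) * ?y $ i \<le> (1 - \<beta>) * ?w $ i"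
    by (rule stieltjes_inverse_mono[OF plus.stieltjes_axioms minus.stieltjes_axioms
          _ plus.A_inverse minus.A_inverse]) (simp add: axis_def)
  have "(1 - \<beta>) * ?y $ i < (1 + \<beta>) * ?y $ i"
    using \<beta> plus_inverse_column_pos by (intro mult_strict_right_mono) auto
  also note le
  finally show ?thesis using \<beta> by (simp add: M_Delta_entry)
qed

text \<open>
  For \<open>i \<noteq> j\<close> the constant term of the equation of column \<open>j\<close> vanishes in row \<open>i\<close>: with \<open>y\<close>, \<open>w\<close> the
  columns of \<open>M\<^sup>+\<close>, \<open>M\<^sup>-\<close> one has \<open>(1 + \<beta>) y\<^sub>i = (\<delta> + \<mu>) (G y)\<^sub>i\<close> and \<open>(1 - \<beta>) w\<^sub>i = (\<delta> - \<mu>) (G w)\<^sub>i\<close>.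
  Since \<open>\<beta> \<delta> < \<mu>\<close>, this time \<open>(1 - \<beta>) w \<le> (1 + \<beta>) y\<close>. Inserting it costs a factor
  \<open>(1 + \<beta>) / (1 - \<beta>)\<close>, and the stronger lower bound on \<open>\<mu>\<close> is exactly what pays for it: it says
  \<open>(\<delta> - \<mu>) / (1 - \<beta>)\<^sup>2 < (\<delta> + \<mu>) / (1 + \<beta>)\<^sup>2\<close>, the comparison of the coefficients of \<open>G\<close> in the two
  Neumann series.
\<close>

lemma M_Delta_offdiagonal_neg:
  assumes "\<mu> > 2 * \<beta> / (1 + \<beta>\<^sup>2) * \<delta>" "\<beta> * \<delta> < \<mu>" "i \<noteq> j"
  shows "M_Delta \<beta> \<delta> \<mu> G $ i $ j < 0"
proof -
  let ?y = "matrix_inv plus.A *v axis j 1" and ?w = "matrix_inv minus.A *v axis j 1"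
  have "(\<delta> - \<mu>) * (1 + \<beta>) \<le> (\<delta> + \<mu>) * (1 - \<beta>)" using assms(2) by (simp add: algebra_simps)
  hence le: "(1 - \<beta>) * ?w $ k \<le> (1 + \<beta>) * ?y $ k" for k
    by (rule stieltjes_inverse_mono[OF minus.stieltjes_axioms plus.stieltjes_axioms
          _ minus.A_inverse plus.A_inverse]) (simp add: axis_def)
  have y: "(1 + \<beta>) * ?y $ i = (\<delta> + \<mu>) * (G *v ?y) $ i"
    using plus.shifted_eq[of "axis j 1" i] assms(3) by (simp add: axis_def)
  have w: "(1 - \<beta>) * ?w $ i = (\<delta> - \<mu>) * (G *v ?w) $ i"
    using minus.shifted_eq[of "axis j 1" i] assms(3) by (simp add: axis_def)
  have "(1 - \<beta>) * (G *v ?w) $ i = (G *v ((1 - \<beta>) *\<^sub>R ?w)) $ i"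
    by (simp add: matrix_vector_mult_scaleR)
  also have "\<dots> \<le> (G *v ((1 + \<beta>) *\<^sub>R ?y)) $ i"
    by (rule nonneg_matrix_mult_mono[OF network_nonneg[OF net]]) (simp add: le)
  also have "\<dots> = (1 + \<beta>) * (G *v ?y) $ i"
    by (simp add: matrix_vector_mult_scaleR)
  finally have Gle: "(1 - \<beta>) * (G *v ?w) $ i \<le> (1 + \<beta>) * (G *v ?y) $ i" .
  have "2 * \<beta> * \<delta> < \<mu> * (1 + \<beta>\<^sup>2)"
    using assms(1) by (simp add: field_simps add_pos_nonneg)
  hence coeff: "(\<delta> - \<mu>) * (1 + \<beta>)\<^sup>2 < (\<delta> + \<mu>) * (1 - \<beta>)\<^sup>2"
    by (simp add: power2_eq_square algebra_simps)
  have "(\<delta> + \<mu>) * ((1 - \<beta>)\<^sup>2 * ?w $ i) = (\<delta> + \<mu>) * (\<delta> - \<mu>) * ((1 - \<beta>) * (G *v ?w) $ i)"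
    using w by (simp add: power2_eq_square mult.assoc mult.left_commute)
  also have "\<dots> \<le> (\<delta> + \<mu>) * (\<delta> - \<mu>) * ((1 + \<beta>) * (G *v ?y) $ i)"
    using Gle \<mu> by (intro mult_left_mono) auto
  also have "\<dots> = (\<delta> - \<mu>) * (1 + \<beta>)\<^sup>2 * ?y $ i"
    using y by (simp add: power2_eq_square mult.assoc mult.left_commute)
  also have "\<dots> < (\<delta> + \<mu>) * (1 - \<beta>)\<^sup>2 * ?y $ i"
    using coeff plus_inverse_column_pos by (rule mult_strict_right_mono)
  finally have "(\<delta> + \<mu>) * (1 - \<beta>)\<^sup>2 * ?w $ i < (\<delta> + \<mu>) * (1 - \<beta>)\<^sup>2 * ?y $ i"
    by (simp only: mult.assoc)
  hence "?w $ i < ?y $ i"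
    using \<beta> \<mu> by (subst (asm) mult_less_cancel_left_pos) auto
  thus ?thesis by (simp add: M_Delta_entry)
qed

text \<open>
  Let \<open>y = M\<^sup>+ 1\<close> and \<open>w = M\<^sup>- 1\<close>. The two matrices being inverted differ by \<open>2 (\<mu> G - \<beta> I)\<close>, so
  \<open>y - w = M\<^sup>- v\<close> for \<open>v = 2 (\<mu> G y - \<beta> y)\<close>, and it suffices that \<open>v > 0\<close>. The equation of \<open>y\<close> turns
  \<open>v\<^sub>i > 0\<close> into the lower bound \<open>(\<mu> - \<beta> \<delta>) y\<^sub>i > \<mu>\<close>, which need only be checked at the smallest entry
  of \<open>y\<close>. There \<open>(G y)\<^sub>k \<ge> d\<^sub>m\<^sub>i\<^sub>n y\<^sub>k\<close>, and \<open>\<mu> d\<^sub>m\<^sub>i\<^sub>n > \<beta>\<close> gives the bound.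
\<close>

lemma influence_neg:
  assumes "\<beta> * \<delta> < \<mu>" "\<beta> < \<mu> * real (min_degree G)"
  shows "influence j < 0"
proof -
  define y where "y = matrix_inv plus.A *v 1"
  define w where "w = matrix_inv minus.A *v 1"
  have y: "(1 + \<beta>) * y $ i = 1 + (\<delta> + \<mu>) * (G *v y) $ i" for i
    using plus.shifted_eq[of 1 i] by (simp add: y_def)
  have y_pos: "0 < y $ i" for i
  proof -
    have "1 \<le> (1 + \<beta>) * y $ i"
      using plus.scaled_ge_image[of y i] by (simp add: y_def plus.A_inverse)
    hence "0 < (1 + \<beta>) * y $ i" by linarith
    thus ?thesis using \<beta> by (simp add: zero_less_mult_iff)
  qed
  define m where "m = Min (range (($) y))"
  have m_le: "m \<le> y $ i" for i by (simp add: m_def)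
  have "m \<in> range (($) y)" unfolding m_def by (intro Min_in) auto
  then obtain k where k: "m = y $ k" by blast
  have m: "0 < m" using k y_pos by simp
  have min: "\<mu> < (\<mu> - \<beta> * \<delta>) * m"
  proof -
    have "\<beta> * m < \<mu> * real (min_degree G) * m" using assms(2) m by simp
    also have "\<dots> \<le> \<mu> * (G *v y) $ k"
      using min_degree_mult_le[OF net less_imp_le[OF m] m_le, of k] \<mu> by (simp add: mult.assoc)
    finally have "(\<delta> + \<mu>) * (\<beta> * m) < (\<delta> + \<mu>) * (\<mu> * (G *v y) $ k)" using \<mu> by simp
    moreover have "\<mu> * ((1 + \<beta>) * m) = \<mu> + (\<delta> + \<mu>) * (\<mu> * (G *v y) $ k)"
      unfolding k y by (simp add: algebra_simps)
    ultimately show ?thesis by (simp add: algebra_simps)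
  qed
  have v: "\<beta> * y $ i < \<mu> * (G *v y) $ i" for i
  proof -
    have "(\<mu> - \<beta> * \<delta>) * m \<le> (\<mu> - \<beta> * \<delta>) * y $ i"
      using assms(1) m_le by (intro mult_left_mono) auto
    with min have "\<mu> < (\<mu> - \<beta> * \<delta>) * y $ i" by linarith
    moreover have "\<mu> * ((1 + \<beta>) * y $ i) = \<mu> + (\<delta> + \<mu>) * (\<mu> * (G *v y) $ i)"
      unfolding y by (simp add: algebra_simps)
    ultimately have "(\<delta> + \<mu>) * (\<beta> * y $ i) < (\<delta> + \<mu>) * (\<mu> * (G *v y) $ i)"
      by (simp add: algebra_simps)
    thus ?thesis using \<mu> by (subst (asm) mult_less_cancel_left_pos) auto
  qed
  have "(minus.A *v (y - w)) $ i = 2 * (\<mu> * (G *v y) $ i - \<beta> * y $ i)" for i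
  proof -
    have "(minus.A *v (y - w)) $ i = (minus.A *v y) $ i - 1"
      by (simp add: matrix_vector_mult_diff_distrib w_def minus.A_inverse)
    thus ?thesis using y[of i] unfolding shifted_mult_component by (simp add: algebra_simps)
  qed
  hence pos: "0 < (minus.A *v (y - w)) $ i" for i using v by simp
  hence "0 < (1 - \<beta>) * (y - w) $ j"
    using minus.scaled_ge_image[of "y - w" j] less_imp_le[OF pos] by (meson less_le_trans)
  thus ?thesis using \<beta> by (simp add: influence_eq y_def w_def zero_less_mult_iff)
qed

text \<open>
  An off-diagonal entry on the complete graph is, up to the factor \<open>1 / n\<close>, the column sum minus the
  reciprocal of \<open>s + t\<close>. The column sum is larger for \<open>M\<^sup>+\<close>, and so is \<open>s + t\<close>: both differences have
  the desired sign.
\<close>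

lemma complete_graph_M_Delta_offdiagonal_neg:
  assumes "\<And>i j. G $ i $ j = (if i = j then 0 else 1)" "influence j < 0" "i \<noteq> j"
  shows "M_Delta \<beta> \<delta> \<mu> G $ i $ j < 0"
proof -
  have "1 / ((1 + \<beta>) + (\<delta> + \<mu>)) < 1 / ((1 - \<beta>) + (\<delta> - \<mu>))"
    using \<beta> \<mu> by (intro divide_strict_left_mono) auto
  hence "influence j - 1 / ((1 - \<beta>) + (\<delta> - \<mu>)) + 1 / ((1 + \<beta>) + (\<delta> + \<mu>)) < 0"
    using assms(2) by linarith
  also have "influence j - 1 / ((1 - \<beta>) + (\<delta> - \<mu>)) + 1 / ((1 + \<beta>) + (\<delta> + \<mu>))
      = real CARD('n) * M_Delta \<beta> \<delta> \<mu> G $ i $ j"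
    using plus.complete_graph_inverse_entry[OF assms(1,3)]
      minus.complete_graph_inverse_entry[OF assms(1,3)]
    by (simp add: M_Delta_def M_plus_def M_minus_def sum_subtractf right_diff_distrib)
  finally show ?thesis by (simp add: mult_less_0_iff)
qed

lemma outcome_s_plus_and_feasible:
  assumes "\<mu> < \<beta> * \<delta>" "pA0 \<le> pmax" "pmax \<noteq> pA0"
  shows "outcome_s_plus \<beta> \<delta> \<mu> G \<and> essentially_feasible \<beta> \<delta> \<mu> G pA0 pB0 pmax"
proof -
  have "0 < influence j" for j
    by (rule sum_pos) (simp_all add: M_Delta_pos[OF assms(1)])
  thus ?thesis
    by (simp add: outcome_s_plus_def M_Delta_pos[OF assms(1)] total_xB_strict_antimono
        essentially_feasible_if_influence_pos assms(2,3))
qed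

lemma outcome_s_minus_and_infeasible:
  assumes "\<And>i j. i \<noteq> j \<Longrightarrow> M_Delta \<beta> \<delta> \<mu> G $ i $ j < 0" "\<And>j. influence j < 0"
  shows "outcome_s_minus \<beta> \<delta> \<mu> G \<and> essentially_infeasible \<beta> \<delta> \<mu> G pA0 pB0 pmax"
  by (simp add: outcome_s_minus_def assms total_xB_strict_mono
      essentially_infeasible_if_influence_neg)

end

section \<open>The complete graph\<close>

definition complete_graph :: "real^'n^'n" where
  "complete_graph = (\<chi> i j. if i = j then 0 else 1)"

lemma complete_graph_entry: "complete_graph $ i $ j = (if i = j then 0 else 1)"
  by (simp add: complete_graph_def)

lemma network_complete_graph: "network (complete_graph :: real^'n^'n)"
proof -
  have "(i, j) \<in> {(k, l). (complete_graph :: real^'n^'n) $ k $ l = 1}\<^sup>*" for i j :: 'n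
  proof (cases "i = j")
    case False
    thus ?thesis by (intro r_into_rtrancl) (simp add: complete_graph_entry)
  qed simp
  thus ?thesis unfolding network_def by (simp add: complete_graph_entry)
qed

lemma min_degree_complete_graph:
  "min_degree (complete_graph :: real^'n^'n) = CARD('n) - 1"
proof -
  have "{j. (complete_graph :: real^'n^'n) $ i $ j = 1} = UNIV - {i}" for i
    by (auto simp: complete_graph_entry)
  hence "node_degree (complete_graph :: real^'n^'n) = (\<lambda>i. CARD('n) - 1)"
    by (simp add: node_degree_def fun_eq_iff card_Diff_singleton)
  thus ?thesis by (simp add: min_degree_def)
qed

text \<open>
  In the row of a largest entry of an eigenvector, the other \<open>n - 1\<close> entries add up to the eigenvalue
  times that entry.
\<close>

lemma spec_radius_complete_graph_le:
  "spec_radius (complete_graph :: real^'n^'n) \<le> real (CARD('n) - 1)"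
proof -
  let ?K = "complete_graph :: real^'n^'n"
  obtain z where "is_eigenvalue ?K z" and rho: "spec_radius ?K = cmod z"
    using spec_radius_attained[OF network_transpose[OF network_complete_graph]] .
  then obtain v where v: "v \<noteq> 0" "map_matrix complex_of_real ?K *v v = z *s v"
    by (auto simp: is_eigenvalue_def)
  define b where "b = Max (range (\<lambda>i. cmod (v $ i)))"
  have le: "cmod (v $ i) \<le> b" for i by (simp add: b_def)
  have "b \<in> range (\<lambda>i. cmod (v $ i))" unfolding b_def by (intro Max_in) auto
  then obtain i where i: "b = cmod (v $ i)" by blast
  obtain k where "v $ k \<noteq> 0" using v(1) by (auto simp: vec_eq_iff)
  hence b: "0 < b" using le[of k] by (smt (verit) zero_less_norm_iff)
  have "z * v $ i = (\<Sum>j\<in>UNIV. complex_of_real (?K $ i $ j) * v $ j)"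
    using arg_cong[OF v(2), of "\<lambda>x. x $ i"] by (simp add: matrix_vector_mult_def)
  also have "\<dots> = (\<Sum>j\<in>UNIV - {i}. v $ j)"
    by (rule sum.mono_neutral_cong_right) (auto simp: complete_graph_entry)
  finally have "cmod z * b = cmod (\<Sum>j\<in>UNIV - {i}. v $ j)"
    by (simp add: i flip: norm_mult)
  also have "\<dots> \<le> real (card (UNIV - {i})) * b"
    by (rule sum_norm_bound) (rule le)
  finally show ?thesis using b by (simp add: rho card_Diff_singleton)
qed

text \<open>
  With \<open>r = \<mu> / \<delta>\<close> fixed, a suitable \<open>\<delta>\<close> has to satisfy \<open>\<beta> < r \<delta> d\<close> for a negative influence and
  \<open>(1 + r) \<delta> d < 1 + \<beta>\<close> for a spectral radius in range, where \<open>d = n - 1\<close> is both the degree and the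
  spectral radius of the complete graph. The window \<open>\<beta> / r < \<delta> d < (1 + \<beta>) / (1 + r)\<close> is open because
  \<open>\<beta> < r\<close>. The second term of the maximum is then the smaller one, again by \<open>\<beta> < r\<close>.
\<close>

lemma unbalanced_complete_graph_game:
  fixes \<beta> r :: real
  assumes \<beta>: "0 < \<beta>" "\<beta> < 1" and r: "\<beta> < r" "r < 1" and card: "2 \<le> CARD('n::finite)"
  obtains \<delta> where "0 < \<delta>" "network_game (complete_graph :: real^'n^'n) \<beta> \<delta> (r * \<delta>)"
    "\<beta> < r * \<delta> * real (min_degree (complete_graph :: real^'n^'n))"
proof -
  let ?K = "complete_graph :: real^'n^'n"
  define d where "d = real (CARD('n) - 1)"
  have d: "1 \<le> d" using card by (simp add: d_def)
  have "\<beta> / r < (1 + \<beta>) / (1 + r)" using \<beta> r by (simp add: field_simps)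
  then obtain e where e: "\<beta> / r < e" "e < (1 + \<beta>) / (1 + r)" by (meson dense)
  have e0: "0 < e" using e(1) \<beta> r by (meson divide_pos_pos less_trans)
  have e1: "\<beta> < r * e" "(1 + r) * e < 1 + \<beta>" using e \<beta> r by (simp_all add: field_simps)
  define \<delta> where "\<delta> = e / d"
  have \<delta>: "0 < \<delta>" "\<delta> * d = e" using e0 d by (simp_all add: \<delta>_def)
  have "(\<delta> - r * \<delta>) * (1 + \<beta>) \<le> (\<delta> + r * \<delta>) * (1 - \<beta>)"
  proof -
    have "\<delta> * \<beta> \<le> \<delta> * r" using \<delta> r by simp
    thus ?thesis by (simp add: algebra_simps)
  qed
  hence "(\<delta> - r * \<delta>) / (1 - \<beta>) \<le> (\<delta> + r * \<delta>) / (1 + \<beta>)"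
    using \<beta> by (simp add: frac_le_eq divide_le_eq field_simps)
  moreover have "0 \<le> \<delta> - r * \<delta>" "0 \<le> \<delta> + r * \<delta>" using \<delta> r \<beta> by (simp_all add: algebra_simps)
  ultimately have "max (\<bar>\<delta> + r * \<delta>\<bar> / (1 + \<beta>)) (\<bar>\<delta> - r * \<delta>\<bar> / (1 - \<beta>)) = (\<delta> + r * \<delta>) / (1 + \<beta>)"
    by simp
  moreover have "(\<delta> + r * \<delta>) / (1 + \<beta>) * spec_radius ?K < 1"
  proof -
    have "(\<delta> + r * \<delta>) * spec_radius ?K \<le> (\<delta> + r * \<delta>) * d"
      using spec_radius_complete_graph_le \<open>0 \<le> \<delta> + r * \<delta>\<close> unfolding d_def by (intro mult_left_mono)
    also have "\<dots> = (1 + r) * e" unfolding \<delta>(2)[symmetric] by (simp add: algebra_simps)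
    also have "\<dots> < 1 + \<beta>" by (rule e1)
    finally show ?thesis using \<beta> by (simp add: divide_less_eq)
  qed
  ultimately have "network_game ?K \<beta> \<delta> (r * \<delta>)"
    using \<beta> r \<delta> by unfold_locales (simp_all add: network_complete_graph)
  moreover have "\<beta> < r * \<delta> * real (min_degree ?K)"
    using e1 unfolding min_degree_complete_graph d_def[symmetric] by (simp add: \<delta>(2) mult.assoc)
  ultimately show ?thesis using that \<delta>(1) by blast
qed

section \<open>Feasibility of the intervention\<close>

theorem theorem1:
  fixes G :: "real^'n^'n"
    and \<beta> \<delta> \<mu> :: real
    and pA0 pB0 pmax :: "real^'n"
  assumes "network G"
    and "0 < \<beta>" and "\<beta> < 1" and "0 < \<delta>" and "0 < \<mu>"
    and "max (\<bar>\<delta> + \<mu>\<bar> / (1 + \<beta>)) (\<bar>\<delta> - \<mu>\<bar> / (1 - \<beta>)) * spec_radius G < 1"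
    and "\<mu> < \<delta>"
    and "0 \<le> pA0" and "0 \<le> pB0" and "pA0 \<le> pmax" and "pmax \<noteq> pA0"
  shows
    "(\<mu> < \<beta> * \<delta> \<longrightarrow>
        outcome_s_plus \<beta> \<delta> \<mu> G \<and> essentially_feasible \<beta> \<delta> \<mu> G pA0 pB0 pmax)
     \<and>
     (2 \<le> CARD('n) \<and> \<mu> > \<beta> * \<delta> \<longrightarrow>
        (\<exists>(G' :: real^'n^'n) \<delta>' \<mu>'.
           network G' \<and> \<delta>' > 0 \<and> \<mu>' = (\<mu> / \<delta>) * \<delta>' \<and>
           \<beta> * \<delta>' < \<mu>' \<and> \<mu>' < \<delta>' \<and>
           max (\<bar>\<delta>' + \<mu>'\<bar> / (1 + \<beta>)) (\<bar>\<delta>' - \<mu>'\<bar> / (1 - \<beta>)) * spec_radius G' < 1 \<and>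
           outcome_s_minus \<beta> \<delta>' \<mu>' G' \<and>
           essentially_infeasible \<beta> \<delta>' \<mu>' G' pA0 pB0 pmax))
     \<and>
     (0 < min_degree G \<and> \<mu> > max (2 * \<beta> / (1 + \<beta>\<^sup>2) * \<delta>) (\<beta> / real (min_degree G)) \<longrightarrow>
        outcome_s_minus \<beta> \<delta> \<mu> G \<and> essentially_infeasible \<beta> \<delta> \<mu> G pA0 pB0 pmax)"
proof (intro conjI[where P = "_ \<longrightarrow> _"] impI)
  interpret network_game G \<beta> \<delta> \<mu> using assms by unfold_locales
  {
    assume "\<mu> < \<beta> * \<delta>"
    thus "outcome_s_plus \<beta> \<delta> \<mu> G \<and> essentially_feasible \<beta> \<delta> \<mu> G pA0 pB0 pmax"
      using outcome_s_plus_and_feasible assms by blast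
  next
    assume asm: "2 \<le> CARD('n) \<and> \<mu> > \<beta> * \<delta>"
    define r where "r = \<mu> / \<delta>"
    have r: "\<beta> < r" "r < 1" using asm assms by (simp_all add: r_def field_simps)
    let ?K = "complete_graph :: real^'n^'n"
    obtain \<delta>' where \<delta>': "0 < \<delta>'" and game: "network_game ?K \<beta> \<delta>' (r * \<delta>')"
      and deg: "\<beta> < r * \<delta>' * real (min_degree ?K)"
      using unbalanced_complete_graph_game[OF assms(2,3) r conjunct1[OF asm]] by blast
    interpret K: network_game ?K \<beta> \<delta>' "r * \<delta>'" by (rule game)
    have "\<beta> * \<delta>' < r * \<delta>'" using r \<delta>' by simp
    moreover from K.influence_neg[OF this deg]
    have "outcome_s_minus \<beta> \<delta>' (r * \<delta>') ?K \<and> essentially_infeasible \<beta> \<delta>' (r * \<delta>') ?K pA0 pB0 pmax"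
      by (intro K.outcome_s_minus_and_infeasible
          K.complete_graph_M_Delta_offdiagonal_neg complete_graph_entry)
    ultimately show "\<exists>(G' :: real^'n^'n) \<delta>' \<mu>'.
           network G' \<and> \<delta>' > 0 \<and> \<mu>' = (\<mu> / \<delta>) * \<delta>' \<and>
           \<beta> * \<delta>' < \<mu>' \<and> \<mu>' < \<delta>' \<and>
           max (\<bar>\<delta>' + \<mu>'\<bar> / (1 + \<beta>)) (\<bar>\<delta>' - \<mu>'\<bar> / (1 - \<beta>)) * spec_radius G' < 1 \<and>
           outcome_s_minus \<beta> \<delta>' \<mu>' G' \<and>
           essentially_infeasible \<beta> \<delta>' \<mu>' G' pA0 pB0 pmax"
      using K.net K.\<mu>(2) K.radius \<delta>' unfolding r_def by blast
  next
    assume asm: "0 < min_degree G \<and> \<mu> > max (2 * \<beta> / (1 + \<beta>\<^sup>2) * \<delta>) (\<beta> / real (min_degree G))"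
    hence deg: "\<beta> < \<mu> * real (min_degree G)" and big: "2 * \<beta> / (1 + \<beta>\<^sup>2) * \<delta> < \<mu>"
      by (simp_all add: divide_less_eq)
    have "\<beta>\<^sup>2 \<le> 1" using \<beta> by (simp add: power_le_one)
    hence "\<beta> \<le> 2 * \<beta> / (1 + \<beta>\<^sup>2)"
      using \<beta> by (simp add: le_divide_eq add_pos_nonneg)
    hence "\<beta> * \<delta> \<le> 2 * \<beta> / (1 + \<beta>\<^sup>2) * \<delta>" using assms(4) by (intro mult_right_mono) auto
    hence "\<beta> * \<delta> < \<mu>" using big by linarith
    thus "outcome_s_minus \<beta> \<delta> \<mu> G \<and> essentially_infeasible \<beta> \<delta> \<mu> G pA0 pB0 pmax"
      by (intro outcome_s_minus_and_infeasible M_Delta_offdiagonal_neg influence_neg big deg)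
  }
qed

end
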